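(* Let $X_1,\ldots,X_{n_x}$ be independent and identically distributed real random variables with $E|X_1|^4<\infty$, and let $Y_1,\ldots,Y_{n_y}$ be independent and identically distributed real random variables with $E|Y_1|^4<\infty$. Assume that the two samples $\{X_i\}$ and $\{Y_j\}$ are independent of each other, and that $\sigma_x,\sigma_y>0$. Let $N=n_x+n_y$ and $k=n_y/n_x$. Then, for the mean difference $D=\bar Y-\bar X$, the skewness $\gamma_D$ and kurtosis $\tau_D$ of $D$ are given by $$\gamma_D=\frac{(1+k)^{1/2}}{\sqrt{Nk}}\,\frac{\gamma_y\sigma_y^3-k^2\gamma_x\sigma_x^3}{(k\sigma_x^2+\sigma_y^2)^{3/2}},$$ $$\tau_D=3+\frac{1+k}{kN}\,\frac{(\tau_y-3)\sigma_y^4+k^3(\tau_x-3)\sigma_x^4}{(\sigma_y^2+k\sigma_x^2)^2}.$$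
   Context: Here $\bar X=n_x^{-1}\sum_{i=1}^{n_x}X_i$ and $\bar Y=n_y^{-1}\sum_{j=1}^{n_y}Y_j$ are the sample means; $\mu_x=E(X_1)$, $\mu_y=E(Y_1)$; $\sigma_x^2=E(X_1-\mu_x)^2$, $\sigma_y^2=E(Y_1-\mu_y)^2$. The skewness and kurtosis of a random variable $Z$ with mean $\mu$ and variance $\sigma^2>0$ are $\sigma^{-3}E(Z-\mu)^3$ and $\sigma^{-4}E(Z-\mu)^4$ (so kurtosis is not excess kurtosis; a normal variable has kurtosis $3$). The skewness and kurtosis of $X_1$ are denoted $\gamma_x,\tau_x$, those of $Y_1$ are denoted $\gamma_y,\tau_y$, and those of $D$ are denoted $\gamma_D,\tau_D$. *)

theory Defs
  imports "HOL-Probability.Probability"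
begin

(* Both moments are meant for Z with finite fourth moment and positive variance.
   The kurtosis is not the excess kurtosis: it is 3 for a normal variable. *)

definition (in prob_space) skewness :: "('a \<Rightarrow> real) \<Rightarrow> real" where
  "skewness Z = expectation (\<lambda>\<omega>. (Z \<omega> - expectation Z) ^ 3) / sqrt (variance Z) ^ 3"

definition (in prob_space) kurtosis :: "('a \<Rightarrow> real) \<Rightarrow> real" where
  "kurtosis Z = expectation (\<lambda>\<omega>. (Z \<omega> - expectation Z) ^ 4) / sqrt (variance Z) ^ 4"

definition (in prob_space) iid_sample :: "nat \<Rightarrow> (nat \<Rightarrow> 'a \<Rightarrow> real) \<Rightarrow> bool" where
  "iid_sample n X \<longleftrightarrow>
     indep_vars (\<lambda>_. borel) X {1..n} \<and>
     (\<forall>i\<in>{1..n}. \<forall>j\<in>{1..n}. distr M borel (X i) = distr M borel (X j))"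

definition sample_vector :: "nat \<Rightarrow> (nat \<Rightarrow> 'a \<Rightarrow> real) \<Rightarrow> 'a \<Rightarrow> nat \<Rightarrow> real" where
  "sample_vector n X \<omega> = (\<lambda>i\<in>{1..n}. X i \<omega>)"

definition sample_mean :: "nat \<Rightarrow> (nat \<Rightarrow> 'a \<Rightarrow> real) \<Rightarrow> 'a \<Rightarrow> real" where
  "sample_mean n X \<omega> = (\<Sum>i=1..n. X i \<omega>) / real n"

(* Only the two samples as random vectors are required to be independent of each
   other here; independence within each sample is part of iid_sample. *)
definition (in prob_space) indep_samples ::
    "nat \<Rightarrow> (nat \<Rightarrow> 'a \<Rightarrow> real) \<Rightarrow> nat \<Rightarrow> (nat \<Rightarrow> 'a \<Rightarrow> real) \<Rightarrow> bool" where
  "indep_samples m X n Y \<longleftrightarrow>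
     indep_var (\<Pi>\<^sub>M i\<in>{1..m}. borel) (sample_vector m X) (\<Pi>\<^sub>M j\<in>{1..n}. borel) (sample_vector n Y)"

end

theory Submission
  imports Defs
begin

(* The second and third central moments and the combination E(Z - m)^4 - 3 (E(Z - m)^2)^2 are the
   cumulants of order two, three and four. They are additive over independent summands and
   homogeneous of degree j = 2, 3, 4 under scaling, so a sample mean has j-th cumulant n^(1 - j)
   times that of one observation. Skewness and excess kurtosis are the cumulants of order three
   and four after normalization by the variance. *)

lemma power_le_one_plus_power4:
  fixes x :: real
  assumes "j \<le> 4"
  shows "\<bar>x\<bar> ^ j \<le> 1 + \<bar>x\<bar> ^ 4"
proof (cases "\<bar>x\<bar> \<le> 1")
  case True
  then have "\<bar>x\<bar> ^ j \<le> 1" by (simp add: power_le_one)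
  then show ?thesis by (rule add_increasing2[rotated]) simp
next
  case False
  then have "\<bar>x\<bar> ^ j \<le> \<bar>x\<bar> ^ 4" using assms by (intro power_increasing) auto
  then show ?thesis by linarith
qed

context prob_space
begin

text \<open>On a probability space constants are integrable, so \<open>1 + Z \<omega> ^ 4\<close>
  dominates all powers up to the fourth.\<close>

lemma integrable_power_le_4:
  fixes Z :: "'a \<Rightarrow> real"
  assumes Z: "random_variable borel Z" and int: "integrable M (\<lambda>\<omega>. Z \<omega> ^ 4)" and "j \<le> 4"
  shows "integrable M (\<lambda>\<omega>. Z \<omega> ^ j)"
proof (rule Bochner_Integration.integrable_bound)
  show "integrable M (\<lambda>\<omega>. 1 + Z \<omega> ^ 4)" using int by simp
  show "(\<lambda>\<omega>. Z \<omega> ^ j) \<in> borel_measurable M" using Z by simp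
  show "AE \<omega> in M. norm (Z \<omega> ^ j) \<le> norm (1 + Z \<omega> ^ 4)"
    using power_le_one_plus_power4[OF \<open>j \<le> 4\<close>] by (auto simp: power_abs)
qed

text \<open>Integrability is part of the predicate because a non-integrable function has expectation
  0 by default, so the equations alone would not ensure that the moments exist. Order four suffices,
  as it controls the lower orders.\<close>

definition has_cumulants :: "('a \<Rightarrow> real) \<Rightarrow> real \<Rightarrow> real \<Rightarrow> real \<Rightarrow> real \<Rightarrow> bool" where
  "has_cumulants Z m c2 c3 c4 \<longleftrightarrow>
     random_variable borel Z \<and> integrable M (\<lambda>\<omega>. (Z \<omega> - m) ^ 4) \<and>
     expectation Z = m \<and>
     expectation (\<lambda>\<omega>. (Z \<omega> - m) ^ 2) = c2 \<and>
     expectation (\<lambda>\<omega>. (Z \<omega> - m) ^ 3) = c3 \<and>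
     expectation (\<lambda>\<omega>. (Z \<omega> - m) ^ 4) = c4 + 3 * c2\<^sup>2"

lemma has_cumulants_integrable:
  assumes "has_cumulants Z m c2 c3 c4" and "j \<le> 4"
  shows "integrable M (\<lambda>\<omega>. (Z \<omega> - m) ^ j)"
proof (rule integrable_power_le_4)
  show "random_variable borel (\<lambda>\<omega>. Z \<omega> - m)"
    using assms(1) by (auto simp: has_cumulants_def)
qed (use assms in \<open>auto simp: has_cumulants_def\<close>)

lemma has_cumulants_centered:
  assumes "has_cumulants Z m c2 c3 c4"
  shows "expectation (\<lambda>\<omega>. Z \<omega> - m) = 0"
proof -
  have "integrable M (\<lambda>\<omega>. (Z \<omega> - m) + m)"
    using has_cumulants_integrable[OF assms, of 1] by (intro Bochner_Integration.integrable_add) simp_all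
  then have "integrable M Z" by simp
  then show ?thesis using assms by (simp add: has_cumulants_def prob_space)
qed

text \<open>Reads the definitions of skewness and kurtosis backwards: the central moments of order
  three and four are the normalized ones times \<sigma>^3 and \<sigma>^4.\<close>

lemma has_cumulants_of_integrable:
  assumes Z: "random_variable borel Z" and int: "integrable M (\<lambda>\<omega>. \<bar>Z \<omega>\<bar> ^ 4)"
    and s: "\<sigma>\<^sup>2 = variance Z" "\<sigma> > 0"
  shows "has_cumulants Z (expectation Z) (\<sigma>\<^sup>2) (skewness Z * \<sigma> ^ 3) ((kurtosis Z - 3) * \<sigma> ^ 4)"
proof -
  define m where "m = expectation Z"
  have i4: "integrable M (\<lambda>\<omega>. Z \<omega> ^ 4)" using int by simp
  note i = integrable_power_le_4[OF Z i4]
  \<comment> \<open>The binomial expansion reduces integrability of the centered power to that of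
    raw powers.\<close>
  have "(\<lambda>\<omega>. (Z \<omega> - m) ^ 4) =
      (\<lambda>\<omega>. Z \<omega> ^ 4 - 4 * m * Z \<omega> ^ 3 + 6 * m\<^sup>2 * Z \<omega> ^ 2 - 4 * m ^ 3 * Z \<omega> ^ 1 + m ^ 4)"
    by (rule ext) algebra
  then have "integrable M (\<lambda>\<omega>. (Z \<omega> - m) ^ 4)"
    using i[of 1] i[of 2] i[of 3] i[of 4] by simp
  moreover have "sqrt (variance Z) = \<sigma>" using s by (metis less_imp_le real_sqrt_unique)
  ultimately show ?thesis
    using Z s unfolding has_cumulants_def skewness_def kurtosis_def m_def
    by (auto simp: field_simps power2_eq_square power4_eq_xxxx)
qed

lemma has_cumulants_skewness:
  "has_cumulants Z m c2 c3 c4 \<Longrightarrow> skewness Z = c3 / sqrt c2 ^ 3"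
  unfolding has_cumulants_def skewness_def by simp

text \<open>The part \<open>3 * c2\<^sup>2\<close> of the fourth central moment normalizes to the
  constant 3; for \<open>c2 = 0\<close> the quotient would be 0 instead.\<close>

lemma has_cumulants_kurtosis:
  assumes "has_cumulants Z m c2 c3 c4" "c2 > 0"
  shows "kurtosis Z = 3 + c4 / c2\<^sup>2"
proof -
  have "sqrt c2 ^ 4 = c2\<^sup>2"
    using assms(2) by (simp add: power4_eq_xxxx power2_eq_square)
  then show ?thesis
    using assms unfolding has_cumulants_def kurtosis_def by (auto simp: field_simps)
qed

text \<open>Every moment condition in \<open>has_cumulants\<close> is an integral against the law of
  the variable, so it passes to any variable with the same law.\<close>

lemma has_cumulants_distr_cong:
  assumes c: "has_cumulants Z m c2 c3 c4" and W: "random_variable borel W"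
    and d: "distr M borel W = distr M borel Z"
  shows "has_cumulants W m c2 c3 c4"
proof -
  have Z: "random_variable borel Z" using c by (simp add: has_cumulants_def)
  have E: "expectation (\<lambda>\<omega>. f (W \<omega>)) = expectation (\<lambda>\<omega>. f (Z \<omega>))"
    if "f \<in> borel_measurable borel" for f :: "real \<Rightarrow> real"
    using integral_distr[OF W that] integral_distr[OF Z that] d by simp
  have "integrable M (\<lambda>\<omega>. (W \<omega> - m) ^ 4)"
    using integrable_distr_eq[OF W, of "\<lambda>x. (x - m) ^ 4"]
      integrable_distr_eq[OF Z, of "\<lambda>x. (x - m) ^ 4"] d c
    by (simp add: has_cumulants_def)
  then show ?thesis
    using c W E[of "\<lambda>x. x"] E[of "\<lambda>x. (x - m) ^ 2"] E[of "\<lambda>x. (x - m) ^ 3"] E[of "\<lambda>x. (x - m) ^ 4"]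
    unfolding has_cumulants_def by simp
qed

lemma has_cumulants_scale:
  assumes "has_cumulants Z m c2 c3 c4"
  shows "has_cumulants (\<lambda>\<omega>. a * Z \<omega>) (a * m) (a\<^sup>2 * c2) (a ^ 3 * c3) (a ^ 4 * c4)"
proof -
  have eq: "(a * z - a * m) ^ j = a ^ j * (z - m) ^ j" for z j
    by (metis power_mult_distrib right_diff_distrib)
  have "a ^ 4 * (c4 + 3 * c2\<^sup>2) = a ^ 4 * c4 + 3 * (a\<^sup>2 * c2)\<^sup>2"
    by algebra
  then show ?thesis
    using assms unfolding has_cumulants_def eq by auto
qed

text \<open>For the centered variables, independence factors each mixed term of the binomial
  expansion, and those containing a first power vanish.\<close>

lemma has_cumulants_add:
  assumes U: "has_cumulants U m b2 b3 b4" and V: "has_cumulants V l c2 c3 c4"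
    and ind: "indep_var borel U borel V"
  shows "has_cumulants (\<lambda>\<omega>. U \<omega> + V \<omega>) (m + l) (b2 + c2) (b3 + c3) (b4 + c4)"
proof -
  define u where "u \<omega> = U \<omega> - m" for \<omega>
  define v where "v \<omega> = V \<omega> - l" for \<omega>
  have iu: "integrable M (\<lambda>\<omega>. u \<omega> ^ j)" and iv: "integrable M (\<lambda>\<omega>. v \<omega> ^ j)" if "j \<le> 4" for j
    using has_cumulants_integrable[OF U that] has_cumulants_integrable[OF V that]
    by (simp_all add: u_def v_def)
  have uv: "indep_var borel (\<lambda>\<omega>. u \<omega> ^ i) borel (\<lambda>\<omega>. v \<omega> ^ j)" for i j
    using indep_var_compose[OF ind, of "\<lambda>x. (x - m) ^ i" borel "\<lambda>x. (x - l) ^ j" borel]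
    by (simp add: comp_def u_def v_def)
  have iuv: "integrable M (\<lambda>\<omega>. u \<omega> ^ i * v \<omega> ^ j)" if "i \<le> 4" "j \<le> 4" for i j
    using indep_var_integrable[OF uv iu[OF that(1)] iv[OF that(2)]] .
  have Euv: "expectation (\<lambda>\<omega>. u \<omega> ^ i * v \<omega> ^ j) =
      expectation (\<lambda>\<omega>. u \<omega> ^ i) * expectation (\<lambda>\<omega>. v \<omega> ^ j)" if "i \<le> 4" "j \<le> 4" for i j
    using indep_var_lebesgue_integral[OF uv iu[OF that(1)] iv[OF that(2)]] .
  have cu: "expectation (\<lambda>\<omega>. u \<omega> ^ 1) = 0" "expectation (\<lambda>\<omega>. u \<omega> ^ 2) = b2"
      "expectation (\<lambda>\<omega>. u \<omega> ^ 3) = b3" "expectation (\<lambda>\<omega>. u \<omega> ^ 4) = b4 + 3 * b2\<^sup>2"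
    using U has_cumulants_centered[OF U] by (simp_all add: u_def has_cumulants_def)
  have cv: "expectation (\<lambda>\<omega>. v \<omega> ^ 1) = 0" "expectation (\<lambda>\<omega>. v \<omega> ^ 2) = c2"
      "expectation (\<lambda>\<omega>. v \<omega> ^ 3) = c3" "expectation (\<lambda>\<omega>. v \<omega> ^ 4) = c4 + 3 * c2\<^sup>2"
    using V has_cumulants_centered[OF V] by (simp_all add: v_def has_cumulants_def)
  \<comment> \<open>First powers are kept as \<open>u \<omega> ^ 1\<close> so that all terms match
    the general facts \<open>iuv\<close> and \<open>Euv\<close>.\<close>
  have e2: "(\<lambda>\<omega>. (u \<omega> + v \<omega>) ^ 2) = (\<lambda>\<omega>. u \<omega> ^ 2 + 2 * (u \<omega> ^ 1 * v \<omega> ^ 1) + v \<omega> ^ 2)"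
    by (rule ext) algebra
  have e3: "(\<lambda>\<omega>. (u \<omega> + v \<omega>) ^ 3) =
      (\<lambda>\<omega>. u \<omega> ^ 3 + 3 * (u \<omega> ^ 2 * v \<omega> ^ 1) + 3 * (u \<omega> ^ 1 * v \<omega> ^ 2) + v \<omega> ^ 3)"
    by (rule ext) algebra
  have e4: "(\<lambda>\<omega>. (u \<omega> + v \<omega>) ^ 4) =
      (\<lambda>\<omega>. u \<omega> ^ 4 + 4 * (u \<omega> ^ 3 * v \<omega> ^ 1) + 6 * (u \<omega> ^ 2 * v \<omega> ^ 2)
        + 4 * (u \<omega> ^ 1 * v \<omega> ^ 3) + v \<omega> ^ 4)"
    by (rule ext) algebra
  note ints = iu[of 1] iu[of 2] iu[of 3] iu[of 4] iv[of 1] iv[of 2] iv[of 3] iv[of 4]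
    iuv[of 1 1] iuv[of 2 1] iuv[of 1 2] iuv[of 3 1] iuv[of 2 2] iuv[of 1 3]
  note exps = Euv[of 1 1] Euv[of 2 1] Euv[of 1 2] Euv[of 3 1] Euv[of 2 2] Euv[of 1 3] cu cv
  have E2: "expectation (\<lambda>\<omega>. (u \<omega> + v \<omega>) ^ 2) = b2 + c2"
    unfolding e2 using ints exps by simp
  have E3: "expectation (\<lambda>\<omega>. (u \<omega> + v \<omega>) ^ 3) = b3 + c3"
    unfolding e3 using ints exps by simp
  \<comment> \<open>The one surviving mixed term, \<open>6 * (b2 * c2)\<close>, is exactly the cross
    term of \<open>3 * (b2 + c2)\<^sup>2\<close>; this is why the fourth cumulant is additive while
    the fourth central moment is not.\<close>
  have "expectation (\<lambda>\<omega>. (u \<omega> + v \<omega>) ^ 4) = (b4 + 3 * b2\<^sup>2) + 6 * (b2 * c2) + (c4 + 3 * c2\<^sup>2)"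
    unfolding e4 using ints exps by simp
  then have E4: "expectation (\<lambda>\<omega>. (u \<omega> + v \<omega>) ^ 4) = (b4 + c4) + 3 * (b2 + c2)\<^sup>2"
    by algebra
  have I4: "integrable M (\<lambda>\<omega>. (u \<omega> + v \<omega>) ^ 4)"
    unfolding e4 using ints by simp
  have eq: "U \<omega> + V \<omega> - (m + l) = u \<omega> + v \<omega>" for \<omega> by (simp add: u_def v_def)
  have "integrable M u" "integrable M v" using iu[of 1] iv[of 1] by simp_all
  then have "expectation (\<lambda>\<omega>. (u \<omega> + m) + (v \<omega> + l)) = m + l"
    using cu(1) cv(1) by (simp add: prob_space)
  then have E1: "expectation (\<lambda>\<omega>. U \<omega> + V \<omega>) = m + l" by (simp add: u_def v_def)
  show ?thesis
    using U V E1 E2 E3 E4 I4 unfolding has_cumulants_def eq by auto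
qed

lemma has_cumulants_sum:
  assumes "finite I" and "indep_vars (\<lambda>_. borel) X I"
    and "\<And>i. i \<in> I \<Longrightarrow> has_cumulants (X i) m c2 c3 c4"
  shows "has_cumulants (\<lambda>\<omega>. \<Sum>i\<in>I. X i \<omega>) (real (card I) * m) (real (card I) * c2)
      (real (card I) * c3) (real (card I) * c4)"
  using assms
proof (induction I rule: finite_induct)
  \<comment> \<open>The empty sum is the constant 0, whose mean and cumulants all vanish.\<close>
  case empty
  then show ?case by (simp add: has_cumulants_def)
next
  case (insert i I)
  have "has_cumulants (\<lambda>\<omega>. \<Sum>i\<in>I. X i \<omega>) (real (card I) * m) (real (card I) * c2)
      (real (card I) * c3) (real (card I) * c4)"
    using insert.prems by (intro insert.IH) (auto intro: indep_vars_subset)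
  from has_cumulants_add[OF insert.prems(2)[of i] this indep_vars_sum[OF insert.hyps insert.prems(1)]]
  show ?case using insert.hyps by (simp add: algebra_simps)
qed

lemma iid_sample_random_variable:
  assumes "iid_sample n X" "i \<in> {1..n}"
  shows "random_variable borel (X i)"
  using assms unfolding iid_sample_def indep_vars_def by auto

lemma has_cumulants_sample_mean:
  assumes iid: "iid_sample n X" and n: "n \<ge> 1" and c: "has_cumulants (X 1) m c2 c3 c4"
  shows "has_cumulants (sample_mean n X) m (c2 / n) (c3 / real n ^ 2) (c4 / real n ^ 3)"
proof -
  have X: "has_cumulants (X i) m c2 c3 c4" if i: "i \<in> {1..n}" for i
  proof (rule has_cumulants_distr_cong[OF c iid_sample_random_variable[OF iid i]])
    \<comment> \<open>Laws are compared only for indices in \<open>{1..n}\<close>, so the sample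
      must be nonempty for the first observation to represent it.\<close>
    have "1 \<in> {1..n}" using n by simp
    then show "distr M borel (X i) = distr M borel (X 1)"
      using iid i unfolding iid_sample_def by blast
  qed
  have "indep_vars (\<lambda>_. borel) X {1..n}" using iid by (simp add: iid_sample_def)
  from has_cumulants_sum[OF finite_atLeastAtMost this X]
  have "has_cumulants (\<lambda>\<omega>. \<Sum>i=1..n. X i \<omega>) (n * m) (n * c2) (n * c3) (n * c4)"
    by simp
  from has_cumulants_scale[OF this, of "1 / n"] n show ?thesis
    by (simp add: sample_mean_def[abs_def] power_divide power2_eq_square power3_eq_cube power4_eq_xxxx)
qed

text \<open>Each mean is a measurable function of its sample vector, and independence survives
  composition with measurable maps.\<close>

lemma indep_samples_sample_mean:
  assumes "indep_samples m X n Y"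
  shows "indep_var borel (sample_mean m X) borel (sample_mean n Y)"
proof -
  have meas: "(\<lambda>f. (\<Sum>i=1..l. f i) / l) \<in> borel_measurable (\<Pi>\<^sub>M i\<in>{1..l}. (borel :: real measure))" for l :: nat
    by measurable
  have "(\<lambda>f. (\<Sum>i=1..l. f i) / l) \<circ> sample_vector l Z = sample_mean l Z" for l and Z :: "nat \<Rightarrow> 'a \<Rightarrow> real"
    by (auto simp: fun_eq_iff sample_vector_def sample_mean_def)
  with indep_var_compose[OF assms[unfolded indep_samples_def] meas meas] show ?thesis by simp
qed

text \<open>The difference is a sum in which the mean of X carries the factor -1; since (-1)^j
  scales the cumulant of order j, only order three changes sign.\<close>

lemma has_cumulants_mean_difference:
  assumes "iid_sample p X" "p \<ge> 1" "has_cumulants (X 1) m b2 b3 b4"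
    and "iid_sample q Y" "q \<ge> 1" "has_cumulants (Y 1) l c2 c3 c4"
    and "indep_samples p X q Y"
  shows "has_cumulants (\<lambda>\<omega>. sample_mean q Y \<omega> - sample_mean p X \<omega>) (l - m)
    (c2 / q + b2 / p) (c3 / real q ^ 2 - b3 / real p ^ 2) (c4 / real q ^ 3 + b4 / real p ^ 3)"
proof -
  have "indep_var borel (\<lambda>\<omega>. - 1 * sample_mean p X \<omega>) borel (sample_mean q Y)"
    using indep_var_compose[OF indep_samples_sample_mean[OF assms(7)], of "\<lambda>x. - 1 * x" borel "\<lambda>x. x" borel]
    by (simp add: comp_def)
  from has_cumulants_add[OF has_cumulants_scale[OF has_cumulants_sample_mean[OF assms(1-3)]]
      has_cumulants_sample_mean[OF assms(4-6)] this]
  show ?thesis by (simp add: add.commute)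
qed

end

theorem theorem1:
  fixes M :: "'a measure"
    and X Y :: "nat \<Rightarrow> 'a \<Rightarrow> real"
    and n\<^sub>x n\<^sub>y :: nat
    and D :: "'a \<Rightarrow> real"
    and N k \<sigma>\<^sub>x \<sigma>\<^sub>y \<gamma>\<^sub>x \<gamma>\<^sub>y \<tau>\<^sub>x \<tau>\<^sub>y :: real
  assumes "prob_space M"
    and "n\<^sub>x \<ge> 1" and "n\<^sub>y \<ge> 1"
    and "prob_space.iid_sample M n\<^sub>x X"
    and "prob_space.iid_sample M n\<^sub>y Y"
    and "prob_space.indep_samples M n\<^sub>x X n\<^sub>y Y"
    and "integrable M (\<lambda>\<omega>. \<bar>X 1 \<omega>\<bar> ^ 4)"
    and "integrable M (\<lambda>\<omega>. \<bar>Y 1 \<omega>\<bar> ^ 4)"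
    and "\<sigma>\<^sub>x\<^sup>2 = prob_space.variance M (X 1)" and "\<sigma>\<^sub>x > 0"
    and "\<sigma>\<^sub>y\<^sup>2 = prob_space.variance M (Y 1)" and "\<sigma>\<^sub>y > 0"
    and "\<gamma>\<^sub>x = prob_space.skewness M (X 1)" and "\<tau>\<^sub>x = prob_space.kurtosis M (X 1)"
    and "\<gamma>\<^sub>y = prob_space.skewness M (Y 1)" and "\<tau>\<^sub>y = prob_space.kurtosis M (Y 1)"
    and "N = real n\<^sub>x + real n\<^sub>y"
    and "k = real n\<^sub>y / real n\<^sub>x"
    and "D = (\<lambda>\<omega>. sample_mean n\<^sub>y Y \<omega> - sample_mean n\<^sub>x X \<omega>)"
  shows "prob_space.skewness M D =
           (1 + k) powr (1/2) / sqrt (N * k) *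
           ((\<gamma>\<^sub>y * \<sigma>\<^sub>y ^ 3 - k\<^sup>2 * \<gamma>\<^sub>x * \<sigma>\<^sub>x ^ 3) / (k * \<sigma>\<^sub>x\<^sup>2 + \<sigma>\<^sub>y\<^sup>2) powr (3/2))
       \<and> prob_space.kurtosis M D =
           3 + (1 + k) / (k * N) *
           (((\<tau>\<^sub>y - 3) * \<sigma>\<^sub>y ^ 4 + k ^ 3 * (\<tau>\<^sub>x - 3) * \<sigma>\<^sub>x ^ 4) / (\<sigma>\<^sub>y\<^sup>2 + k * \<sigma>\<^sub>x\<^sup>2)\<^sup>2)"
proof -
  interpret prob_space M by fact
  note a = assms(2-)
  have px: "real n\<^sub>x > 0" and py: "real n\<^sub>y > 0" using a(1,2) by auto
  have X: "has_cumulants (X 1) (expectation (X 1)) (\<sigma>\<^sub>x\<^sup>2) (\<gamma>\<^sub>x * \<sigma>\<^sub>x ^ 3) ((\<tau>\<^sub>x - 3) * \<sigma>\<^sub>x ^ 4)"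
    unfolding a(12,13)
    by (intro has_cumulants_of_integrable iid_sample_random_variable[OF a(3)] a) (use a(1) in auto)
  have Y: "has_cumulants (Y 1) (expectation (Y 1)) (\<sigma>\<^sub>y\<^sup>2) (\<gamma>\<^sub>y * \<sigma>\<^sub>y ^ 3) ((\<tau>\<^sub>y - 3) * \<sigma>\<^sub>y ^ 4)"
    unfolding a(14,15)
    by (intro has_cumulants_of_integrable iid_sample_random_variable[OF a(4)] a) (use a(2) in auto)
  note D = has_cumulants_mean_difference[OF a(3,1) X a(4,2) Y a(5), folded a(18)]
  \<comment> \<open>The rest is algebra: all cumulants of D are brought over powers of
    \<open>n\<^sub>y\<close> by means of \<open>n\<^sub>y = k * n\<^sub>x\<close>, and the variance
    of D becomes V divided by \<open>n\<^sub>y\<close>.\<close>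
  define V where "V = k * \<sigma>\<^sub>x\<^sup>2 + \<sigma>\<^sub>y\<^sup>2"
  have k: "k > 0" using px py a(17) by simp
  have V: "V > 0" using k a(9,11) by (simp add: V_def add_pos_pos)
  have ny: "real n\<^sub>y = k * real n\<^sub>x" using px a(17) by simp
  \<comment> \<open>Since \<open>N = (1 + k) * n\<^sub>x\<close>, the factor \<open>1 + k\<close>
    cancels in both prefactors of the claim, leaving \<open>1 / sqrt n\<^sub>y\<close> and
    \<open>1 / n\<^sub>y\<close>.\<close>
  have N: "N * k = (1 + k) * real n\<^sub>y" using px a(16,17) by (simp add: field_simps)
  have v: "\<sigma>\<^sub>y\<^sup>2 / n\<^sub>y + \<sigma>\<^sub>x\<^sup>2 / n\<^sub>x = V / n\<^sub>y"
    using px k unfolding V_def ny by (simp add: field_simps)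
  have c3: "\<gamma>\<^sub>y * \<sigma>\<^sub>y ^ 3 / real n\<^sub>y ^ 2 - \<gamma>\<^sub>x * \<sigma>\<^sub>x ^ 3 / real n\<^sub>x ^ 2
      = (\<gamma>\<^sub>y * \<sigma>\<^sub>y ^ 3 - k\<^sup>2 * \<gamma>\<^sub>x * \<sigma>\<^sub>x ^ 3) / real n\<^sub>y ^ 2"
    using px k unfolding ny by (simp add: field_simps)
  have c4: "(\<tau>\<^sub>y - 3) * \<sigma>\<^sub>y ^ 4 / real n\<^sub>y ^ 3 + (\<tau>\<^sub>x - 3) * \<sigma>\<^sub>x ^ 4 / real n\<^sub>x ^ 3
      = ((\<tau>\<^sub>y - 3) * \<sigma>\<^sub>y ^ 4 + k ^ 3 * (\<tau>\<^sub>x - 3) * \<sigma>\<^sub>x ^ 4) / real n\<^sub>y ^ 3"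
    using px k unfolding ny by (simp add: divide_simps)
  \<comment> \<open>Links the real exponent of the claim with the cubed square root in the
    definition of skewness.\<close>
  have pow: "V powr (3/2) = sqrt V ^ 3"
  proof -
    have "V powr (3/2) = (V powr (1/2)) powr real 3" by (simp only: powr_powr) simp
    also have "\<dots> = sqrt V ^ 3" using V by (subst powr_realpow) (simp_all add: powr_half_sqrt)
    finally show ?thesis .
  qed
  have f3: "(1 + k) powr (1/2) / sqrt (N * k) = 1 / sqrt n\<^sub>y"
    using k unfolding N by (simp add: powr_half_sqrt real_sqrt_mult)
  have f4: "(1 + k) / (k * N) = 1 / n\<^sub>y"
    using k N by (simp add: mult.commute)
  \<comment> \<open>Read from right to left, this turns the denominator of the third cumulant into a
    fourth power of \<open>sqrt n\<^sub>y\<close>; three of these factors cancel against the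
    normalization.\<close>
  have s4: "sqrt (real n\<^sub>y) ^ 4 = real n\<^sub>y ^ 2"
    by (simp add: power4_eq_xxxx power2_eq_square)
  have "skewness D = (\<gamma>\<^sub>y * \<sigma>\<^sub>y ^ 3 - k\<^sup>2 * \<gamma>\<^sub>x * \<sigma>\<^sub>x ^ 3) / real n\<^sub>y ^ 2 / sqrt (V / n\<^sub>y) ^ 3"
    using has_cumulants_skewness[OF D] unfolding v c3 .
  also have "\<dots> = 1 / sqrt n\<^sub>y * ((\<gamma>\<^sub>y * \<sigma>\<^sub>y ^ 3 - k\<^sup>2 * \<gamma>\<^sub>x * \<sigma>\<^sub>x ^ 3) / sqrt V ^ 3)"
    using py V unfolding s4[symmetric] real_sqrt_divide power_divide
    by (simp add: divide_simps power3_eq_cube power4_eq_xxxx)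
  finally have "skewness D = (1 + k) powr (1/2) / sqrt (N * k) *
      ((\<gamma>\<^sub>y * \<sigma>\<^sub>y ^ 3 - k\<^sup>2 * \<gamma>\<^sub>x * \<sigma>\<^sub>x ^ 3) / (k * \<sigma>\<^sub>x\<^sup>2 + \<sigma>\<^sub>y\<^sup>2) powr (3/2))"
    unfolding f3 pow[unfolded V_def] V_def .
  moreover have "kurtosis D = 3 + ((\<tau>\<^sub>y - 3) * \<sigma>\<^sub>y ^ 4 + k ^ 3 * (\<tau>\<^sub>x - 3) * \<sigma>\<^sub>x ^ 4) / real n\<^sub>y ^ 3 / (V / n\<^sub>y)\<^sup>2"
    using has_cumulants_kurtosis[OF D] V py unfolding v c4 by simp
  \<comment> \<open>The cube of \<open>n\<^sub>y\<close> from the fourth cumulant meets the square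
    from the squared variance, so one factor remains.\<close>
  then have "kurtosis D = 3 + 1 / n\<^sub>y * (((\<tau>\<^sub>y - 3) * \<sigma>\<^sub>y ^ 4 + k ^ 3 * (\<tau>\<^sub>x - 3) * \<sigma>\<^sub>x ^ 4) / V\<^sup>2)"
    using py by (simp add: power_divide power2_eq_square power3_eq_cube)
  ultimately show ?thesis unfolding f4 V_def by (simp add: add.commute)
qed

end
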